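(* Let $A$ be a ring, let $(B,N)$ be a fuzzy Banach algebra and let $(C,N')$ be a fuzzy normed space. Let $\varphi: A\times A\to C$ be a function such that for some real $\alpha$ with $0<\alpha<2$, $$N'(\varphi(2a,2b),t)\ \geq\ N'(\alpha\varphi(a,b),t)$$ for all $a,b\in A$ and all $t>0$. Suppose that $f:A\to B$ is a function such that $$N(f(a+b)-f(a)-f(b),t)\ \geq\ N'(\varphi(a,b),t)$$ and $$N(f(ab)-f(a)f(b),s)\ \geq\ N'(\varphi(a,b),s)$$ for all $a,b\in A$ and all $t,s>0$. Then there exists a unique ring homomorphism $h:A\to B$ such that $$N(f(a)-h(a),t)\ \geq\ N'\!\left(\frac{2\varphi(a,a)}{2-\alpha},t\right)$$ for all $a\in A$ and all $t>0$.
   Context: Fuzzy norm: let $X$ be a real linear space. A function $N:X\times\mathbb{R}\to[0,1]$ is a fuzzy norm on $X$ if for all $x,y\in X$ and all $a,b\in\mathbb{R}$: (N1) $N(x,a)=0$ for $a\le 0$; (N2) $x=0$ if and only if $N(x,a)=1$ for all $a>0$; (N3) $N(ax,b)=N(x,b/|a|)$ if $a\ne 0$; (N4) $N(x+y,a+b)\ge\min\{N(x,a),N(y,b)\}$; (N5) $N(x,\cdot)$ is non-decreasing on $\mathbb{R}$ and $\lim_{a\to\infty}N(x,a)=1$; (N6) for $x\neq 0$, $N(x,\cdot)$ is (upper semi) continuous on $\mathbb{R}$. The pair $(X,N)$ is then called a fuzzy normed (linear) space. Convergence and completeness: a sequence $\{x_n\}$ in $X$ converges to $x\in X$ if $\lim_{n\to\infty}N(x_n-x,a)=1$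 for all $a>0$. It is Cauchy if for each $\epsilon>0$ and each $a>0$ there exists $n_0$ such that $N(x_{n+p}-x_n,a)>1-\epsilon$ for all $n\ge n_0$ and all $p>0$. The fuzzy normed space is complete if every Cauchy sequence converges. Fuzzy Banach algebra: a pair $(X,N)$ where $X$ is a (real) algebra, $(X,N)$ is a complete fuzzy normed space, and $N(xy,ab)\ge\min\{N(x,a),N(y,b)\}$ for all $x,y\in X$ and all $a,b\in\mathbb{R}$. Ring homomorphism: a map $h$ with $h(a+b)=h(a)+h(b)$ and $h(ab)=h(a)h(b)$ for all $a,b$ (no identity element is assumed or required to be preserved). *)

theory Defs
  imports Complex_Main
begin

definition upper_semicontinuous :: "('a::topological_space \<Rightarrow> real) \<Rightarrow> bool" where
  "upper_semicontinuous f \<longleftrightarrow> (\<forall>x c. f x < c \<longrightarrow> (\<forall>\<^sub>F y in nhds x. f y < c))"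

(* The continuity axiom (N6) is imposed in its upper semicontinuous form, which is
   implied by continuity: see continuous_imp_upper_semicontinuous. *)
locale fuzzy_normed_space =
  fixes N :: "'a::real_vector \<Rightarrow> real \<Rightarrow> real"
  assumes N_range: "N x a \<in> {0..1}"
    and N1: "a \<le> 0 \<Longrightarrow> N x a = 0"
    and N2: "x = 0 \<longleftrightarrow> (\<forall>a>0. N x a = 1)"
    and N3: "a \<noteq> 0 \<Longrightarrow> N (a *\<^sub>R x) b = N x (b / \<bar>a\<bar>)"
    and N4: "min (N x a) (N y b) \<le> N (x + y) (a + b)"
    and N5_mono: "mono (N x)"
    and N5_lim: "(N x \<longlongrightarrow> 1) at_top"
    and N6: "x \<noteq> 0 \<Longrightarrow> upper_semicontinuous (N x)"

lemma continuous_imp_upper_semicontinuous: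
  assumes "continuous_on UNIV f"
  shows "upper_semicontinuous f"
proof -
  have "(f \<longlongrightarrow> f x) (nhds x)" for x
    using assms unfolding continuous_on_def tendsto_at_iff_tendsto_nhds by blast
  then show ?thesis
    unfolding upper_semicontinuous_def by (blast dest: order_tendstoD(2))
qed

definition fuzzy_converges ::
    "('a::real_vector \<Rightarrow> real \<Rightarrow> real) \<Rightarrow> (nat \<Rightarrow> 'a) \<Rightarrow> 'a \<Rightarrow> bool" where
  "fuzzy_converges N X x \<longleftrightarrow> (\<forall>a>0. (\<lambda>n. N (X n - x) a) \<longlonglongrightarrow> 1)"

definition fuzzy_Cauchy :: "('a::real_vector \<Rightarrow> real \<Rightarrow> real) \<Rightarrow> (nat \<Rightarrow> 'a) \<Rightarrow> bool" where
  "fuzzy_Cauchy N X \<longleftrightarrow>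
     (\<forall>\<epsilon>>0. \<forall>a>0. \<exists>n0. \<forall>n\<ge>n0. \<forall>p>0. N (X (n + p) - X n) a > 1 - \<epsilon>)"

locale complete_fuzzy_normed_space = fuzzy_normed_space +
  assumes complete: "fuzzy_Cauchy N X \<Longrightarrow> \<exists>x. fuzzy_converges N X x"

locale fuzzy_Banach_algebra = complete_fuzzy_normed_space N
  for N :: "'a::real_algebra \<Rightarrow> real \<Rightarrow> real" +
  assumes N_mult: "min (N x a) (N y b) \<le> N (x * y) (a * b)"

(* Class ring does not assume a unit, so no preservation of 1 is asked for. *)
definition ring_homomorphism :: "('a::ring \<Rightarrow> 'b::ring) \<Rightarrow> bool" where
  "ring_homomorphism h \<longleftrightarrow>
     (\<forall>a b. h (a + b) = h a + h b) \<and> (\<forall>a b. h (a * b) = h a * h b)"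

end

theory Submission
  imports Defs
begin

text \<open>
  The proof is the direct method of Hyers. Writing \<open>2\<^sup>n a\<close> for the \<open>n\<close>-fold doubling of \<open>a\<close>, the
  homomorphism is the limit \<open>h a\<close> of the sequence \<open>f (2\<^sup>n a) / 2\<^sup>n\<close>. Each doubling of the arguments
  multiplies the control function \<open>\<phi>\<close> by at most \<open>\<alpha>\<close>, whereas the division by \<open>2\<^sup>n\<close> stretches the
  second argument of the fuzzy norm by \<open>2\<^sup>n\<close>. Errors after \<open>n\<close> steps are therefore governed by
  \<open>N' (\<phi> a b) ((2 / \<alpha>)\<^sup>n t)\<close>, which tends to 1 because \<open>\<alpha> < 2\<close>.

  Three consequences of this one principle give the theorem. The sequence is Cauchy, and all its
  terms stay within the same distance of \<open>f a\<close> (\<open>hyers_near\<close>), which the limit inherits up to a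
  factor 2. The additivity defect of the sequence tends to 0, so \<open>h\<close> is additive; for the
  multiplicativity defect the relevant scale is \<open>4\<^sup>n\<close>, and \<open>f (2\<^sup>n a * 2\<^sup>n b) / 4\<^sup>n\<close> is the term of
  index \<open>2 n\<close> of the sequence at \<open>a * b\<close>, so \<open>h\<close> is multiplicative, multiplication being
  continuous in a fuzzy Banach algebra (\<open>converges_mult\<close>). Finally, every additive map that lies
  within a multiple of \<open>\<phi> a a\<close> of \<open>f\<close> is itself a limit of the sequence (\<open>hyers_converges_to\<close>),
  and limits are unique.
\<close>

section \<open>Limits in fuzzy normed spaces\<close>

context fuzzy_normed_space
begin

lemma N_le_1: "N x a \<le> 1"
  using N_range[of x a] by simp

lemma N_scale_pos: "c > 0 \<Longrightarrow> N (c *\<^sub>R x) t = N x (t / c)"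
  using N3[of c x t] by simp

lemma N_minus: "N (- x) t = N x t"
  using N3[of "- 1" x t] by simp

lemma N_minus_commute: "N (x - y) t = N (y - x) t"
  using N_minus[of "x - y" t] by simp

lemma N_add_ge:
  assumes "c \<le> N x s" "c \<le> N y t"
  shows "c \<le> N (x + y) (s + t)"
  using N4[of x s y t] assms by linarith

lemma N_zero: "a > 0 \<Longrightarrow> N 0 a = 1"
  using N2[of 0] by simp

lemma N_close_to_1:
  assumes "e > 0"
  shows "\<exists>M>0. 1 - e < N y M"
proof -
  have "\<forall>\<^sub>F M in at_top. 1 - e < N y M"
    using order_tendstoD(1)[OF N5_lim, of "1 - e"] assms by simp
  with eventually_gt_at_top[of 0] have "\<forall>\<^sub>F M in at_top. 0 < M \<and> 1 - e < N y M"
    by eventually_elim simp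
  thus ?thesis
    using eventually_happens by force
qed

lemma N_geometric_tendsto_1:
  assumes "c > 1" "t > 0"
  shows "(\<lambda>n. N x (c ^ n * t)) \<longlonglongrightarrow> 1"
proof -
  have "filterlim (\<lambda>n. c ^ n) at_top sequentially"
    using assms(1) filterlim_realpow_sequentially_gt1[of c]
    by (intro filterlim_at_infinity_imp_filterlim_at_top) auto
  hence "filterlim (\<lambda>n. c ^ n * t) at_top sequentially"
    using assms(2) filterlim_at_top_mult_tendsto_pos[OF tendsto_const] by blast
  thus ?thesis by (rule filterlim_compose[OF N5_lim])
qed

lemma N_tendsto_1_lower:
  assumes "\<And>n. g n \<le> N (X n) t" "g \<longlonglongrightarrow> 1"
  shows "(\<lambda>n. N (X n) t) \<longlonglongrightarrow> 1"
  by (rule tendsto_sandwich[OF _ _ assms(2) tendsto_const]) (use assms(1) N_le_1 in auto)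

lemma convergesI_eventually:
  assumes "\<And>e t. e > 0 \<Longrightarrow> t > 0 \<Longrightarrow> \<forall>\<^sub>F n in sequentially. 1 - e < N (X n - x) t"
  shows "fuzzy_converges N X x"
  unfolding fuzzy_converges_def
proof (intro allI impI)
  fix t :: real assume t: "t > 0"
  show "(\<lambda>n. N (X n - x) t) \<longlonglongrightarrow> 1"
  proof (rule order_tendstoI)
    fix a :: real assume "a < 1"
    thus "\<forall>\<^sub>F n in sequentially. a < N (X n - x) t"
      using assms[of "1 - a", OF _ t] by simp
  next
    fix a :: real assume "1 < a"
    thus "\<forall>\<^sub>F n in sequentially. N (X n - x) t < a"
      by (intro always_eventually allI) (rule le_less_trans[OF N_le_1])
  qed
qed

lemma convergesD_eventually:
  assumes "fuzzy_converges N X x" "e > 0" "t > 0"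
  shows "\<forall>\<^sub>F n in sequentially. 1 - e < N (X n - x) t"
  using assms order_tendstoD(1)[of "\<lambda>n. N (X n - x) t" 1 sequentially "1 - e"]
  unfolding fuzzy_converges_def by simp

lemma converges_shift_zero: "fuzzy_converges N X x \<longleftrightarrow> fuzzy_converges N (\<lambda>n. X n - x) 0"
  unfolding fuzzy_converges_def by simp

lemma converges_add:
  assumes "fuzzy_converges N X x" "fuzzy_converges N Y y"
  shows "fuzzy_converges N (\<lambda>n. X n + Y n) (x + y)"
proof (rule convergesI_eventually)
  fix e t :: real assume et: "e > 0" "t > 0"
  from et have t2: "t / 2 > 0" by simp
  from convergesD_eventually[OF assms(1) et(1) t2] convergesD_eventually[OF assms(2) et(1) t2]
  show "\<forall>\<^sub>F n in sequentially. 1 - e < N (X n + Y n - (x + y)) t"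
  proof eventually_elim
    case (elim n)
    have "1 - e < min (N (X n - x) (t / 2)) (N (Y n - y) (t / 2))"
      using elim by simp
    also have "\<dots> \<le> N ((X n - x) + (Y n - y)) (t / 2 + t / 2)" by (rule N4)
    also have "(X n - x) + (Y n - y) = X n + Y n - (x + y)" by simp
    finally show ?case by simp
  qed
qed

lemma converges_minus:
  assumes "fuzzy_converges N X x"
  shows "fuzzy_converges N (\<lambda>n. - X n) (- x)"
proof -
  have "N (- X n - - x) t = N (X n - x) t" for n t
    using N_minus[of "X n - x" t] by simp
  thus ?thesis using assms unfolding fuzzy_converges_def by simp
qed

lemma converges_diff:
  assumes "fuzzy_converges N X x" "fuzzy_converges N Y y"
  shows "fuzzy_converges N (\<lambda>n. X n - Y n) (x - y)"
  using converges_add[OF assms(1) converges_minus[OF assms(2)]] by simp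

lemma converges_subseq:
  assumes "fuzzy_converges N X x" "strict_mono r"
  shows "fuzzy_converges N (\<lambda>n. X (r n)) x"
  using assms LIMSEQ_subseq_LIMSEQ[OF _ assms(2)] unfolding fuzzy_converges_def comp_def by blast

lemma converges_unique:
  assumes "fuzzy_converges N X x" "fuzzy_converges N X y"
  shows "x = y"
proof -
  have "fuzzy_converges N (\<lambda>n. 0) (x - y)"
    using converges_diff[OF assms] by simp
  hence "N (0 - (x - y)) t = 1" if "t > 0" for t
    using that unfolding fuzzy_converges_def by (simp add: LIMSEQ_const_iff)
  hence "0 - (x - y) = 0" using N2 by blast
  thus ?thesis by simp
qed

text \<open>
  The slack \<open>t - s\<close> absorbs the distance from the sequence to its limit. In the estimate for the
  homomorphism, \<open>s = t / 2\<close>, which accounts for the factor 2 there.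
\<close>

lemma converges_lower_bound:
  assumes "fuzzy_converges N X x" "\<And>n. b \<le> N (X n - y) s" "s < t"
  shows "b \<le> N (x - y) t"
proof -
  have "(\<lambda>n. N (X n - x) (t - s)) \<longlonglongrightarrow> 1"
    using assms(1,3) unfolding fuzzy_converges_def by simp
  hence lim: "(\<lambda>n. min (N (X n - x) (t - s)) b) \<longlonglongrightarrow> min 1 b"
    by (intro tendsto_min tendsto_const)
  have "min (N (X n - x) (t - s)) b \<le> N (x - y) t" for n
    using N4[of "x - X n" "t - s" "X n - y" s] assms(2)[of n] N_minus_commute[of x "X n"] by simp
  hence "min 1 b \<le> N (x - y) t"
    using LIMSEQ_le_const2[OF lim] by blast
  moreover have "b \<le> 1" using assms(2)[of 0] N_le_1 order_trans by blast
  ultimately show ?thesis by simp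
qed

end

context fuzzy_Banach_algebra
begin

text \<open>
  Multiplication by a fixed element \<open>y\<close> is continuous because \<open>N y M\<close> is close to 1 for large \<open>M\<close>:
  the submultiplicativity of \<open>N\<close>, applied at \<open>t = (t / M) * M\<close>, then bounds the product.
\<close>

lemma converges_mult_right_zero:
  assumes "fuzzy_converges N X 0"
  shows "fuzzy_converges N (\<lambda>n. X n * y) 0"
proof (rule convergesI_eventually)
  fix e t :: real assume et: "e > 0" "t > 0"
  obtain M where M: "M > 0" "1 - e < N y M"
    using N_close_to_1[OF et(1)] by blast
  from convergesD_eventually[OF assms et(1), of "t / M"] et(2) M(1)
  have "\<forall>\<^sub>F n in sequentially. 1 - e < N (X n) (t / M)" by simp
  thus "\<forall>\<^sub>F n in sequentially. 1 - e < N (X n * y - 0) t"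
  proof eventually_elim
    case (elim n)
    thus ?case using N_mult[of "X n" "t / M" y M] M by simp
  qed
qed

lemma converges_mult_left_zero:
  assumes "fuzzy_converges N X 0"
  shows "fuzzy_converges N (\<lambda>n. y * X n) 0"
proof (rule convergesI_eventually)
  fix e t :: real assume et: "e > 0" "t > 0"
  obtain M where M: "M > 0" "1 - e < N y M"
    using N_close_to_1[OF et(1)] by blast
  from convergesD_eventually[OF assms et(1), of "t / M"] et(2) M(1)
  have "\<forall>\<^sub>F n in sequentially. 1 - e < N (X n) (t / M)" by simp
  thus "\<forall>\<^sub>F n in sequentially. 1 - e < N (y * X n - 0) t"
  proof eventually_elim
    case (elim n)
    thus ?case using N_mult[of y M "X n" "t / M"] M by simp
  qed
qed

lemma converges_mult_zero_zero:
  assumes "fuzzy_converges N X 0" "fuzzy_converges N Y 0"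
  shows "fuzzy_converges N (\<lambda>n. X n * Y n) 0"
proof (rule convergesI_eventually)
  fix e t :: real assume et: "e > 0" "t > 0"
  from convergesD_eventually[OF assms(1) et] convergesD_eventually[OF assms(2) et(1) zero_less_one]
  show "\<forall>\<^sub>F n in sequentially. 1 - e < N (X n * Y n - 0) t"
  proof eventually_elim
    case (elim n)
    thus ?case using N_mult[of "X n" t "Y n" 1] by simp
  qed
qed

lemma converges_mult:
  assumes "fuzzy_converges N X x" "fuzzy_converges N Y y"
  shows "fuzzy_converges N (\<lambda>n. X n * Y n) (x * y)"
proof -
  have X0: "fuzzy_converges N (\<lambda>n. X n - x) 0" and Y0: "fuzzy_converges N (\<lambda>n. Y n - y) 0"
    using assms converges_shift_zero by blast+
  have "fuzzy_converges N
      (\<lambda>n. (X n - x) * (Y n - y) + (X n - x) * y + x * (Y n - y)) (0 + 0 + 0)"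
    by (intro converges_add converges_mult_zero_zero[OF X0 Y0] converges_mult_right_zero[OF X0]
        converges_mult_left_zero[OF Y0])
  moreover have "(X n - x) * (Y n - y) + (X n - x) * y + x * (Y n - y) = X n * Y n - x * y" for n
    by (simp add: algebra_simps)
  ultimately show ?thesis using converges_shift_zero by simp
qed

end

section \<open>Iterated doubling\<close>

text \<open>
  A ring without unit contains no copy of the numeral \<open>2 ^ n\<close>, so the multiple \<open>2\<^sup>n a\<close> is formed by
  repeated addition.
\<close>

primrec dbl :: "nat \<Rightarrow> 'a::ab_semigroup_add \<Rightarrow> 'a" where
  "dbl 0 a = a"
| "dbl (Suc n) a = dbl n (a + a)"

lemma dbl_add: "dbl n (a + b) = dbl n a + dbl n b"
proof (induction n arbitrary: a b)
  case (Suc n)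
  have "(a + b) + (a + b) = (a + a) + (b + b)" by (simp add: ac_simps)
  thus ?case using Suc[of "a + a" "b + b"] by simp
qed simp

lemma dbl_dbl: "dbl n (dbl m a) = dbl (m + n) a"
  by (induction m arbitrary: a) auto

lemma dbl_mult_left: "dbl n (a * b) = dbl n a * (b::'a::ring)"
  by (induction n arbitrary: a) (auto simp flip: distrib_right)

lemma dbl_mult_right: "dbl n (a * b) = (a::'a::ring) * dbl n b"
  by (induction n arbitrary: b) (auto simp flip: distrib_left)

lemma dbl_mult_dbl: "dbl n a * dbl n b = dbl (n + n) (a * (b::'a::ring))"
  by (metis dbl_mult_left dbl_mult_right dbl_dbl)

lemma additive_dbl:
  fixes h :: "'a::ab_semigroup_add \<Rightarrow> 'b::real_vector"
  assumes "\<And>a b. h (a + b) = h a + h b"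
  shows "h (dbl n a) = 2 ^ n *\<^sub>R h a"
  by (induction n arbitrary: a) (simp_all add: assms algebra_simps flip: scaleR_2)

section \<open>The Hyers sequence of an approximate homomorphism\<close>

locale fuzzy_approximate_homomorphism =
  fuzzy_Banach_algebra N + C: fuzzy_normed_space N'
  for N :: "'b::real_algebra \<Rightarrow> real \<Rightarrow> real"
    and N' :: "'c::real_vector \<Rightarrow> real \<Rightarrow> real" +
  fixes \<phi> :: "'a::ring \<Rightarrow> 'a \<Rightarrow> 'c"
    and f :: "'a \<Rightarrow> 'b"
    and \<alpha> :: real
  assumes \<alpha>_pos: "0 < \<alpha>" and \<alpha>_less_2: "\<alpha> < 2"
    and \<phi>_double: "t > 0 \<Longrightarrow> N' (\<alpha> *\<^sub>R \<phi> a b) t \<le> N' (\<phi> (a + a) (b + b)) t"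
    and f_add: "t > 0 \<Longrightarrow> N' (\<phi> a b) t \<le> N (f (a + b) - f a - f b) t"
    and f_mult: "t > 0 \<Longrightarrow> N' (\<phi> a b) t \<le> N (f (a * b) - f a * f b) t"
begin

definition hyers :: "nat \<Rightarrow> 'a \<Rightarrow> 'b" where
  "hyers n a = (1 / 2 ^ n) *\<^sub>R f (dbl n a)"

lemma \<phi>_dbl:
  assumes "t > 0"
  shows "N' (\<phi> a b) (t / \<alpha> ^ n) \<le> N' (\<phi> (dbl n a) (dbl n b)) t"
proof (induction n arbitrary: a b)
  case (Suc n)
  have "N' (\<phi> a b) (t / \<alpha> ^ Suc n) = N' (\<alpha> *\<^sub>R \<phi> a b) (t / \<alpha> ^ n)"
    using \<alpha>_pos by (simp add: C.N_scale_pos mult.commute)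
  also have "\<dots> \<le> N' (\<phi> (a + a) (b + b)) (t / \<alpha> ^ n)"
    using \<phi>_double assms \<alpha>_pos by simp
  also have "\<dots> \<le> N' (\<phi> (dbl n (a + a)) (dbl n (b + b))) t" by (rule Suc)
  finally show ?case by simp
qed simp

lemma \<phi>_dbl_scaled:
  assumes "t > 0" "c > 0"
  shows "N' (\<phi> a b) ((c / \<alpha>) ^ n * t) \<le> N' (\<phi> (dbl n a) (dbl n b)) (c ^ n * t)"
  using \<phi>_dbl[of "c ^ n * t" a b n] assms by (simp add: power_divide)

lemma \<phi>_tendsto_1:
  assumes "c \<ge> 2" "t > 0"
  shows "(\<lambda>n. N' z ((c / \<alpha>) ^ n * t)) \<longlonglongrightarrow> 1"
  using assms \<alpha>_pos \<alpha>_less_2 by (intro C.N_geometric_tendsto_1) auto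

text \<open>
  Instead of telescoping the sequence and summing a geometric series, the estimate is proved for all
  arguments at once by peeling off the first doubling,
  \<open>hyers (n + 1) a - f a = (hyers n (2 a) - f (2 a)) / 2 + (f (2 a) - 2 f a) / 2\<close>.
  Splitting \<open>t\<close> as \<open>\<alpha> t / 2 + (2 - \<alpha>) t / 2\<close> makes both summands obey the same bound, which is
  again the claimed one; this is where the constant \<open>2 - \<alpha>\<close> comes from.
\<close>

lemma hyers_near:
  assumes "t > 0"
  shows "N' (\<phi> a a) ((2 - \<alpha>) * t) \<le> N (hyers n a - f a) t"
  using assms
proof (induction n arbitrary: a t)
  case 0
  thus ?case by (simp add: hyers_def N_zero C.N_le_1)
next
  case (Suc n)
  have split: "hyers (Suc n) a - f a
      = (1 / 2) *\<^sub>R (hyers n (a + a) - f (a + a)) + (1 / 2) *\<^sub>R (f (a + a) - f a - f a)"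
  proof -
    have "(1 / 2) *\<^sub>R f a + (1 / 2) *\<^sub>R f a = f a" by (simp flip: scaleR_left_distrib)
    thus ?thesis by (simp add: hyers_def scaleR_diff_right diff_diff_eq)
  qed
  have t: "(\<alpha> * t) / 2 + ((2 - \<alpha>) * t) / 2 = t" by (simp add: field_simps)
  have pos: "\<alpha> * t > 0" "(2 - \<alpha>) * t > 0" "(2 - \<alpha>) * (\<alpha> * t) > 0"
    using Suc.prems \<alpha>_pos \<alpha>_less_2 by simp_all
  have "N' (\<phi> a a) ((2 - \<alpha>) * t) \<le> N' (\<phi> (a + a) (a + a)) ((2 - \<alpha>) * (\<alpha> * t))"
    using \<phi>_dbl[OF pos(3), of a a 1] \<alpha>_pos by simp
  also have "\<dots> \<le> N (hyers n (a + a) - f (a + a)) (\<alpha> * t)"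
    using Suc.IH pos(1) by simp
  also have "\<dots> = N ((1 / 2) *\<^sub>R (hyers n (a + a) - f (a + a))) ((\<alpha> * t) / 2)"
    by (simp add: N_scale_pos)
  finally have 1: "N' (\<phi> a a) ((2 - \<alpha>) * t)
      \<le> N ((1 / 2) *\<^sub>R (hyers n (a + a) - f (a + a))) ((\<alpha> * t) / 2)" .
  have "N' (\<phi> a a) ((2 - \<alpha>) * t) \<le> N (f (a + a) - f a - f a) ((2 - \<alpha>) * t)"
    using f_add pos(2) by simp
  also have "\<dots> = N ((1 / 2) *\<^sub>R (f (a + a) - f a - f a)) (((2 - \<alpha>) * t) / 2)"
    by (simp add: N_scale_pos)
  finally show ?case
    using N_add_ge[OF 1] split t by metis
qed

text \<open>
  The tail of the sequence at \<open>a\<close> from index \<open>n\<close> on is \<open>1 / 2\<^sup>n\<close> times the sequence at \<open>2\<^sup>n a\<close>, so the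
  Cauchy property is the previous estimate at the argument \<open>2\<^sup>n a\<close>.
\<close>

lemma hyers_tail:
  assumes "t > 0"
  shows "N' (\<phi> a a) ((2 / \<alpha>) ^ n * ((2 - \<alpha>) * t)) \<le> N (hyers (n + p) a - hyers n a) t"
proof -
  have "N' (\<phi> a a) ((2 / \<alpha>) ^ n * ((2 - \<alpha>) * t))
      \<le> N' (\<phi> (dbl n a) (dbl n a)) (2 ^ n * ((2 - \<alpha>) * t))"
    using \<phi>_dbl_scaled assms \<alpha>_less_2 by simp
  also have "\<dots> \<le> N (hyers p (dbl n a) - f (dbl n a)) (2 ^ n * t)"
    using hyers_near[of "2 ^ n * t" "dbl n a" p] assms by (simp add: mult.left_commute)
  also have "\<dots> = N ((1 / 2 ^ n) *\<^sub>R (hyers p (dbl n a) - f (dbl n a))) t"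
    by (simp add: N_scale_pos mult.commute)
  also have "(1 / 2 ^ n) *\<^sub>R (hyers p (dbl n a) - f (dbl n a)) = hyers (n + p) a - hyers n a"
    by (simp add: hyers_def scaleR_diff_right dbl_dbl power_add)
  finally show ?thesis .
qed

lemma hyers_Cauchy: "fuzzy_Cauchy N (\<lambda>n. hyers n a)"
  unfolding fuzzy_Cauchy_def
proof (intro allI impI)
  fix e t :: real assume et: "e > 0" "t > 0"
  have "(\<lambda>n. N' (\<phi> a a) ((2 / \<alpha>) ^ n * ((2 - \<alpha>) * t))) \<longlonglongrightarrow> 1"
    using \<phi>_tendsto_1 et \<alpha>_less_2 by simp
  hence "\<forall>\<^sub>F n in sequentially. 1 - e < N' (\<phi> a a) ((2 / \<alpha>) ^ n * ((2 - \<alpha>) * t))"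
    by (rule order_tendstoD(1)) (use et in simp)
  then obtain n0 where "\<And>n. n \<ge> n0 \<Longrightarrow> 1 - e < N' (\<phi> a a) ((2 / \<alpha>) ^ n * ((2 - \<alpha>) * t))"
    unfolding eventually_sequentially by blast
  thus "\<exists>n0. \<forall>n\<ge>n0. \<forall>p>0. 1 - e < N (hyers (n + p) a - hyers n a) t"
    using hyers_tail[OF et(2)] less_le_trans by blast
qed

definition hyers_limit :: "'a \<Rightarrow> 'b" where
  "hyers_limit a = (SOME y. fuzzy_converges N (\<lambda>n. hyers n a) y)"

lemma hyers_converges: "fuzzy_converges N (\<lambda>n. hyers n a) (hyers_limit a)"
  unfolding hyers_limit_def using complete[OF hyers_Cauchy] by (rule someI_ex)

lemma hyers_limit_near:
  assumes "t > 0"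
  shows "N' ((2 / (2 - \<alpha>)) *\<^sub>R \<phi> a a) t \<le> N (f a - hyers_limit a) t"
proof -
  have "N' ((2 / (2 - \<alpha>)) *\<^sub>R \<phi> a a) t = N' (\<phi> a a) ((2 - \<alpha>) * (t / 2))"
    using \<alpha>_less_2 by (simp add: C.N_scale_pos mult.commute)
  hence "N' ((2 / (2 - \<alpha>)) *\<^sub>R \<phi> a a) t \<le> N (hyers n a - f a) (t / 2)" for n
    using hyers_near[of "t / 2" a n] assms by simp
  hence "N' ((2 / (2 - \<alpha>)) *\<^sub>R \<phi> a a) t \<le> N (hyers_limit a - f a) t"
    by (rule converges_lower_bound[OF hyers_converges]) (use assms in simp)
  thus ?thesis by (simp add: N_minus_commute)
qed

section \<open>The limit is a ring homomorphism\<close>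

lemma hyers_add_defect:
  "fuzzy_converges N (\<lambda>n. hyers n (a + b) - hyers n a - hyers n b) 0"
  unfolding fuzzy_converges_def
proof (intro allI impI)
  fix t :: real assume t: "t > 0"
  have "N' (\<phi> a b) ((2 / \<alpha>) ^ n * t) \<le> N (hyers n (a + b) - hyers n a - hyers n b - 0) t" for n
  proof -
    have "N' (\<phi> a b) ((2 / \<alpha>) ^ n * t) \<le> N' (\<phi> (dbl n a) (dbl n b)) (2 ^ n * t)"
      using \<phi>_dbl_scaled t by simp
    also have "\<dots> \<le> N (f (dbl n a + dbl n b) - f (dbl n a) - f (dbl n b)) (2 ^ n * t)"
      using f_add t by simp
    also have "\<dots> = N ((1 / 2 ^ n) *\<^sub>R (f (dbl n a + dbl n b) - f (dbl n a) - f (dbl n b))) t"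
      by (simp add: N_scale_pos mult.commute)
    finally show ?thesis by (simp add: hyers_def scaleR_diff_right dbl_add)
  qed
  thus "(\<lambda>n. N (hyers n (a + b) - hyers n a - hyers n b - 0) t) \<longlonglongrightarrow> 1"
    by (rule N_tendsto_1_lower) (rule \<phi>_tendsto_1[OF order_refl t])
qed

lemma hyers_limit_add: "hyers_limit (a + b) = hyers_limit a + hyers_limit b"
proof -
  have "fuzzy_converges N (\<lambda>n. hyers n (a + b) - hyers n a - hyers n b)
      (hyers_limit (a + b) - hyers_limit a - hyers_limit b)"
    by (intro converges_diff hyers_converges)
  hence "hyers_limit (a + b) - hyers_limit a - hyers_limit b = 0"
    using hyers_add_defect converges_unique by blast
  thus ?thesis by (simp add: algebra_simps)
qed

text \<open>
  Both factors of the product are scaled by \<open>1 / 2\<^sup>n\<close>, whereas \<open>2\<^sup>n a * 2\<^sup>n b = 2\<^sup>2\<^sup>n (a * b)\<close>; hence the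
  index \<open>n + n\<close>.
\<close>

lemma hyers_mult_defect:
  "fuzzy_converges N (\<lambda>n. hyers (n + n) (a * b) - hyers n a * hyers n b) 0"
  unfolding fuzzy_converges_def
proof (intro allI impI)
  fix t :: real assume t: "t > 0"
  have "N' (\<phi> a b) ((4 / \<alpha>) ^ n * t) \<le> N (hyers (n + n) (a * b) - hyers n a * hyers n b - 0) t"
    for n
  proof -
    have four: "(4::real) ^ n = 2 ^ n * 2 ^ n" by (simp flip: power_mult_distrib)
    have "N' (\<phi> a b) ((4 / \<alpha>) ^ n * t) \<le> N' (\<phi> (dbl n a) (dbl n b)) (4 ^ n * t)"
      using \<phi>_dbl_scaled t by simp
    also have "\<dots> \<le> N (f (dbl n a * dbl n b) - f (dbl n a) * f (dbl n b)) (4 ^ n * t)"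
      using f_mult t by simp
    also have "\<dots> = N ((1 / 4 ^ n) *\<^sub>R (f (dbl n a * dbl n b) - f (dbl n a) * f (dbl n b))) t"
      by (simp add: N_scale_pos mult.commute)
    finally show ?thesis
      by (simp add: hyers_def scaleR_diff_right dbl_mult_dbl power_add four)
  qed
  thus "(\<lambda>n. N (hyers (n + n) (a * b) - hyers n a * hyers n b - 0) t) \<longlonglongrightarrow> 1"
    by (rule N_tendsto_1_lower) (use \<phi>_tendsto_1 t in simp)
qed

lemma hyers_limit_mult: "hyers_limit (a * b) = hyers_limit a * hyers_limit b"
proof -
  have "strict_mono (\<lambda>n::nat. n + n)" by (simp add: strict_mono_def)
  hence "fuzzy_converges N (\<lambda>n. hyers (n + n) (a * b)) (hyers_limit (a * b))"
    by (rule converges_subseq[OF hyers_converges])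
  hence "fuzzy_converges N (\<lambda>n. hyers (n + n) (a * b) - hyers n a * hyers n b)
      (hyers_limit (a * b) - hyers_limit a * hyers_limit b)"
    by (intro converges_diff converges_mult hyers_converges)
  hence "hyers_limit (a * b) - hyers_limit a * hyers_limit b = 0"
    using hyers_mult_defect converges_unique by blast
  thus ?thesis by simp
qed

section \<open>Uniqueness\<close>

text \<open>
  An additive \<open>h\<close> satisfies \<open>h a = h (2\<^sup>n a) / 2\<^sup>n\<close>, so its distance to the Hyers sequence at \<open>a\<close> is the
  distance from \<open>f\<close> to \<open>h\<close> at \<open>2\<^sup>n a\<close>, scaled down by \<open>2\<^sup>n\<close>.
\<close>

lemma hyers_converges_to:
  assumes add: "\<And>a b. h (a + b) = h a + h b"
    and near: "\<And>a t. t > 0 \<Longrightarrow> N' (c *\<^sub>R \<phi> a a) t \<le> N (f a - h a) t"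
    and c: "c > 0"
  shows "fuzzy_converges N (\<lambda>n. hyers n a) (h a)"
  unfolding fuzzy_converges_def
proof (intro allI impI)
  fix t :: real assume t: "t > 0"
  have "N' (\<phi> a a) ((2 / \<alpha>) ^ n * (t / c)) \<le> N (hyers n a - h a) t" for n
  proof -
    have "N' (\<phi> a a) ((2 / \<alpha>) ^ n * (t / c)) \<le> N' (\<phi> (dbl n a) (dbl n a)) (2 ^ n * (t / c))"
      by (rule \<phi>_dbl_scaled) (use t c in simp_all)
    also have "\<dots> = N' (c *\<^sub>R \<phi> (dbl n a) (dbl n a)) (2 ^ n * t)"
      using c by (simp add: C.N_scale_pos)
    also have "\<dots> \<le> N (f (dbl n a) - h (dbl n a)) (2 ^ n * t)"
      using near t by simp
    also have "\<dots> = N ((1 / 2 ^ n) *\<^sub>R (f (dbl n a) - h (dbl n a))) t"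
      by (simp add: N_scale_pos mult.commute)
    finally show ?thesis by (simp add: hyers_def scaleR_diff_right additive_dbl[of h, OF add])
  qed
  thus "(\<lambda>n. N (hyers n a - h a) t) \<longlonglongrightarrow> 1"
    by (rule N_tendsto_1_lower) (rule \<phi>_tendsto_1, use t c in simp_all)
qed

end

section \<open>Existence and uniqueness of the homomorphism\<close>

theorem theorem2p2:
  fixes N :: "'b::real_algebra \<Rightarrow> real \<Rightarrow> real"
    and N' :: "'c::real_vector \<Rightarrow> real \<Rightarrow> real"
    and \<phi> :: "'a::ring \<Rightarrow> 'a \<Rightarrow> 'c"
    and f :: "'a \<Rightarrow> 'b"
    and \<alpha> :: real
  assumes "fuzzy_Banach_algebra N"
    and "fuzzy_normed_space N'"
    and "0 < \<alpha>" and "\<alpha> < 2"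
    and "\<And>a b t. t > 0 \<Longrightarrow> N' (\<phi> (a + a) (b + b)) t \<ge> N' (\<alpha> *\<^sub>R \<phi> a b) t"
    and "\<And>a b t. t > 0 \<Longrightarrow> N (f (a + b) - f a - f b) t \<ge> N' (\<phi> a b) t"
    and "\<And>a b s. s > 0 \<Longrightarrow> N (f (a * b) - f a * f b) s \<ge> N' (\<phi> a b) s"
  shows "\<exists>!h. ring_homomorphism h \<and>
           (\<forall>a. \<forall>t>0. N (f a - h a) t \<ge> N' ((2 / (2 - \<alpha>)) *\<^sub>R \<phi> a a) t)"
proof -
  interpret fuzzy_approximate_homomorphism N N' \<phi> f \<alpha>
    using assms
    by (intro fuzzy_approximate_homomorphism.intro fuzzy_approximate_homomorphism_axioms.intro)
  show ?thesis
  proof (rule ex1I[of _ hyers_limit])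
    show "ring_homomorphism hyers_limit \<and>
        (\<forall>a. \<forall>t>0. N (f a - hyers_limit a) t \<ge> N' ((2 / (2 - \<alpha>)) *\<^sub>R \<phi> a a) t)"
      using hyers_limit_add hyers_limit_mult hyers_limit_near
      unfolding ring_homomorphism_def by blast
  next
    fix h assume h: "ring_homomorphism h \<and>
        (\<forall>a. \<forall>t>0. N (f a - h a) t \<ge> N' ((2 / (2 - \<alpha>)) *\<^sub>R \<phi> a a) t)"
    have "fuzzy_converges N (\<lambda>n. hyers n a) (h a)" for a
      using h \<alpha>_less_2 unfolding ring_homomorphism_def
      by (intro hyers_converges_to[where c = "2 / (2 - \<alpha>)"]) auto
    thus "h = hyers_limit"
      using hyers_converges converges_unique by blast
  qed
qed

end
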